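(* Let $T$ be a task and let all data be fixed in a task-consistent snapshot. Assume TTL completeness and next-hop closure: for every agent $i$, $\mathcal V_i^H=\{j\in V_{\rm svc}:h(i,j)\le H_{\rm ctrl}\}$ with $h_i(j)=h(i,j)$ for all $j\in\mathcal V_i^H$, and whenever $j\in\mathcal V_i^H$, $j\neq i$ and $k=next_i(j)$, one has $j\in\mathcal V_k^H$ and $h_k(j)=h_i(j)-1$. Assume $\mathcal E_{s_T}^{H,+}(T)\neq\emptyset$. Suppose further that $\Psi_s^*(T)>0$ and $H_{\rm ctrl}\ge\operatorname{diam}(G)$. If SPFR started at $s_T$ terminates at executor $m$, then $$m\in\operatorname*{arg\,max}_{j\in\mathcal A_T^0}\overline U_T(j)\exp[-\omega_h h(s_T,j)].$$
   Context: Snapshot. All data below come from one consistent control-plane snapshot and stay fixed while task $T$ is processed. $G=(V,E)$ is the finite undirected graph of agents in the snapshot; $h(i,j)$ is the shortest-hop distance in $G$ ($\infty$ if disconnected), and $\operatorname{diam}(G)=\max_{i,j\in V}h(i,j)$. $V_{\rm svc}\subseteq V$ is the set of service-capable agents. Utility and eligibility. Each $j\in V_{\rm svc}$ has $p_j$ capabilities, a state (active/inactive), trust $\tau_j\in[0,1]$, queue $Q_j\ge0$, service rate $\mu_j>0$, unit price $\pi^{\rm unit}_j\ge0$. Task $T$ has source $s_T\in V$, $m_T\ge1$ requirements, workload $\ell_T\ge0$, threshold $\theta_T$, minimum trust $\tau_T^{\min}$, budget $B_T$, deadline $D_T^{\max}$. $M_{ab}(j,T)\in[0,1]$ is the similarity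 of capability $a$ of $j$ with requirement $b$. $\mathcal X_j(T)$ is the set of binary matrices $[x_{ab}]$ with $\sum_a x_{ab}=1$ for each $b$, $\sum_b x_{ab}\le1$ for each $a$, and $x_{ab}=0$ if $M_{ab}(j,T)<\theta_T$. If $\mathcal X_j(T)=\emptyset$ then $\chi_j^{\rm cap}(T)=S(j,T)=0$; else $\chi_j^{\rm cap}(T)=1$ and $S(j,T)=m_T^{-1}\max_{\mathbf x\in\mathcal X_j(T)}\sum_{a,b}x_{ab}M_{ab}(j,T)$. With constants $\Delta_{\rm ref},\Pi_{\rm ref}>0$ and weights $w_s,w_l,w_p\ge0$ summing to 1: $D_j^{\rm exec}(T)=(Q_j+\ell_T)/\mu_j$, $\rho_j^T=\min\{(Q_j+\ell_T)/(\mu_j\Delta_{\rm ref}),1\}$, $\pi_j(T)=\pi_j^{\rm unit}\ell_T$, $\widetilde\pi_j(T)=\min\{\pi_j(T)/\Pi_{\rm ref},1\}$, and $U_T(j)=w_sS(j,T)+w_l(1-\rho_j^T)+w_p(1-\widetilde\pi_j(T))\in[0,1]$. Given return-route data $valid_j^{\rm ret}(s_T)\in\{0,1\}$, $K_j^{\rm ret}(s_T)\ge0$, $D_j^{\rm ret}(s_T)\ge0$, the eligible set $\mathcal A_T^0\subseteq V_{\rm svc}$ consists of the active $j\in V_{\rm svc}$ with $\chi_j^{\rm cap}(T)=1$, $\rho_j^T<1$, $\tau_j\ge\tau_T^{\min}$, $valid_j^{\rm ret}(s_T)=1$, $\pi_j(T)+K_j^{\rm ret}(s_T)\le B_T$,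 $D_j^{\rm exec}(T)+D_j^{\rm ret}(s_T)\le D_T^{\max}$. The gated utility is $\overline U_T(j)=U_T(j)$ if $j\in\mathcal A_T^0$ and $0$ otherwise. Local tables. $H_{\rm ctrl}\in\mathbb Z_{\ge0}$ is the control horizon. Each agent $i$ has a set $\mathcal V_i^H\subseteq V_{\rm svc}$ of visible service agents, and for each $j\in\mathcal V_i^H$ a stored hop distance $h_i(j)$ and a next hop $next_i(j)$. If $i\in V_{\rm svc}$ then $i\in\mathcal V_i^H$, $h_i(i)=0$ and $next_i(i)=i$; for $j\ne i$, $next_i(j)$ is a neighbor of $i$ in $G$ lying on a shortest-hop path from $i$ to $j$. Potentials. Fix $\omega_h>0$. For $j\in\mathcal V_i^H$, $\phi_i(j,T)=\overline U_T(j)\exp[-\omega_h h_i(j)]$. Let $\mathcal E_i^H(T)=\mathcal A_T^0\cap\mathcal V_i^H$ and $\mathcal E_i^{H,+}(T)=\{j\in\mathcal E_i^H(T):\overline U_T(j)>0\}$. The global hop-regularized objective value is $\Psi_s^*(T)=\max_{j\in\mathcal A_T^0}\overline U_T(j)\exp[-\omega_h h(s_T,j)]$, with $\max\emptyset=0$. SPFR (frozen rule). Start at $i=s_T$. At the current agent $i$: if $\mathcal E_i^{H,+}(T)=\emptyset$, stop and return "no route". Otherwise let $j_i^{\rm dom}$ be a maximizer of $\phi_i(\cdot,T)$ over $\mathcal E_i^{H,+}(T)$, ties broken deterministically by a fixed total order on agent identifiers. If $j_i^{\rm dom}=i$, terminate with $i$ as executor. Otherwise, if $|V|-1$ forwarding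 steps have already been made, return "no route"; else make a nonterminal forwarding step to $next_i(j_i^{\rm dom})$ (forwarding over a link of $G$ succeeds in the frozen analysis) and repeat. *)

theory Defs
  imports Complex_Main "HOL-Library.Extended_Nat" "Graph_Theory.Pair_Digraph"
begin

text \<open>
  The infimum of the empty set in \<^typ>\<open>enat\<close> is \<open>\<infinity>\<close>, which is the convention for disconnected
  pairs of vertices.
\<close>

definition hop_dist :: "'a pair_pre_digraph \<Rightarrow> 'a \<Rightarrow> 'a \<Rightarrow> enat" where
  "hop_dist G u v = (INF p \<in> {p. pre_digraph.awalk (with_proj G) u p v}. enat (length p))"

definition hop_diam :: "'a pair_pre_digraph \<Rightarrow> enat" where
  "hop_diam G = Max {hop_dist G u v | u v. u \<in> pverts G \<and> v \<in> pverts G}"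

definition on_shortest_path :: "'a pair_pre_digraph \<Rightarrow> 'a \<Rightarrow> 'a \<Rightarrow> 'a \<Rightarrow> bool" where
  "on_shortest_path G u v k \<longleftrightarrow>
     (\<exists>p. pre_digraph.apath (with_proj G) u p v \<and> enat (length p) = hop_dist G u v \<and>
          k \<in> set (pawalk_verts u p))"

text \<open>The value of \<open>exp (- \<omega> d)\<close>, with \<open>exp (- \<infinity>) = 0\<close> at infinite distance.\<close>

definition hop_decay :: "real \<Rightarrow> enat \<Rightarrow> real" where
  "hop_decay \<omega> d = (case d of enat n \<Rightarrow> exp (- \<omega> * real n) | \<infinity> \<Rightarrow> 0)"

text \<open>
  Elements of the type \<open>'a\<close> are the agent identifiers. Functions on agents are meaningful only on
  the agents of the snapshot (service attributes only on service-capable ones), and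
  \<open>stored_hop S i j\<close> and \<open>next_hop S i j\<close> only for \<open>j\<close> visible from \<open>i\<close>.
  The return-route data take the service agent first and the task source second.
\<close>

record 'a snapshot =
  graph_of :: "'a pair_pre_digraph"
  svc :: "'a set"
  num_caps :: "'a \<Rightarrow> nat"
  active :: "'a \<Rightarrow> bool"
  trust :: "'a \<Rightarrow> real"
  queue :: "'a \<Rightarrow> real"
  service_rate :: "'a \<Rightarrow> real"
  unit_price :: "'a \<Rightarrow> real"
  ret_valid :: "'a \<Rightarrow> 'a \<Rightarrow> bool"
  ret_cost :: "'a \<Rightarrow> 'a \<Rightarrow> real"
  ret_delay :: "'a \<Rightarrow> 'a \<Rightarrow> real"
  delay_ref :: real
  price_ref :: real
  w_sim :: real
  w_load :: real
  w_price :: real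
  hop_weight :: real
  horizon :: nat
  visible :: "'a \<Rightarrow> 'a set"
  stored_hop :: "'a \<Rightarrow> 'a \<Rightarrow> nat"
  next_hop :: "'a \<Rightarrow> 'a \<Rightarrow> 'a"

text \<open>
  \<open>similarity T j a b\<close> compares capability \<open>a < num_caps S j\<close> of agent \<open>j\<close> with requirement
  \<open>b < num_reqs T\<close>; both are numbered from \<open>0\<close>.
\<close>

record 'a task =
  source :: 'a
  num_reqs :: nat
  workload :: real
  threshold :: real
  min_trust :: real
  budget :: real
  deadline :: real
  similarity :: "'a \<Rightarrow> nat \<Rightarrow> nat \<Rightarrow> real"

locale task_snapshot =
  fixes S :: "'a snapshot" and T :: "'a task"
  assumes graph: "pair_graph (graph_of S)"
    and svc_subset: "svc S \<subseteq> pverts (graph_of S)"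
    and trust_range: "\<And>j. j \<in> svc S \<Longrightarrow> 0 \<le> trust S j \<and> trust S j \<le> 1"
    and queue_nonneg: "\<And>j. j \<in> svc S \<Longrightarrow> 0 \<le> queue S j"
    and service_rate_pos: "\<And>j. j \<in> svc S \<Longrightarrow> 0 < service_rate S j"
    and unit_price_nonneg: "\<And>j. j \<in> svc S \<Longrightarrow> 0 \<le> unit_price S j"
    and ret_cost_nonneg: "\<And>j. j \<in> svc S \<Longrightarrow> 0 \<le> ret_cost S j (source T)"
    and ret_delay_nonneg: "\<And>j. j \<in> svc S \<Longrightarrow> 0 \<le> ret_delay S j (source T)"
    and refs_pos: "0 < delay_ref S" "0 < price_ref S"
    and weights_nonneg: "0 \<le> w_sim S" "0 \<le> w_load S" "0 \<le> w_price S"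
    and weights_sum: "w_sim S + w_load S + w_price S = 1"
    and hop_weight_pos: "0 < hop_weight S"
    and visible_subset: "\<And>i. i \<in> pverts (graph_of S) \<Longrightarrow> visible S i \<subseteq> svc S"
    and visible_self: "\<And>i. i \<in> svc S \<Longrightarrow>
          i \<in> visible S i \<and> stored_hop S i i = 0 \<and> next_hop S i i = i"
    and next_hop_shortest: "\<And>i j. i \<in> pverts (graph_of S) \<Longrightarrow> j \<in> visible S i \<Longrightarrow> j \<noteq> i \<Longrightarrow>
          (i, next_hop S i j) \<in> parcs (graph_of S) \<and>
          on_shortest_path (graph_of S) i j (next_hop S i j)"
    and source_agent: "source T \<in> pverts (graph_of S)"
    and num_reqs_pos: "1 \<le> num_reqs T"
    and workload_nonneg: "0 \<le> workload T"
    and similarity_range: "\<And>j a b. j \<in> svc S \<Longrightarrow> a < num_caps S j \<Longrightarrow> b < num_reqs T \<Longrightarrow>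
          0 \<le> similarity T j a b \<and> similarity T j a b \<le> 1"

text \<open>
  Matrices are functions vanishing outside the index range, so that each matrix has exactly one
  representation.
\<close>

definition assignments :: "'a snapshot \<Rightarrow> 'a task \<Rightarrow> 'a \<Rightarrow> (nat \<Rightarrow> nat \<Rightarrow> real) set" where
  "assignments S T j =
     {x. (\<forall>a b. x a b \<in> {0, 1}) \<and>
         (\<forall>a b. a \<ge> num_caps S j \<or> b \<ge> num_reqs T \<longrightarrow> x a b = 0) \<and>
         (\<forall>b<num_reqs T. (\<Sum>a<num_caps S j. x a b) = 1) \<and>
         (\<forall>a<num_caps S j. (\<Sum>b<num_reqs T. x a b) \<le> 1) \<and>
         (\<forall>a<num_caps S j. \<forall>b<num_reqs T. similarity T j a b < threshold T \<longrightarrow> x a b = 0)}"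

definition cap_ind :: "'a snapshot \<Rightarrow> 'a task \<Rightarrow> 'a \<Rightarrow> nat" where
  "cap_ind S T j = (if assignments S T j = {} then 0 else 1)"

definition cap_score :: "'a snapshot \<Rightarrow> 'a task \<Rightarrow> 'a \<Rightarrow> real" where
  "cap_score S T j =
     (if assignments S T j = {} then 0
      else Max ((\<lambda>x. \<Sum>a<num_caps S j. \<Sum>b<num_reqs T. x a b * similarity T j a b)
                  ` assignments S T j) / real (num_reqs T))"

definition exec_delay :: "'a snapshot \<Rightarrow> 'a task \<Rightarrow> 'a \<Rightarrow> real" where
  "exec_delay S T j = (queue S j + workload T) / service_rate S j"

definition load :: "'a snapshot \<Rightarrow> 'a task \<Rightarrow> 'a \<Rightarrow> real" where
  "load S T j = min ((queue S j + workload T) / (service_rate S j * delay_ref S)) 1"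

definition price :: "'a snapshot \<Rightarrow> 'a task \<Rightarrow> 'a \<Rightarrow> real" where
  "price S T j = unit_price S j * workload T"

definition norm_price :: "'a snapshot \<Rightarrow> 'a task \<Rightarrow> 'a \<Rightarrow> real" where
  "norm_price S T j = min (price S T j / price_ref S) 1"

definition utility :: "'a snapshot \<Rightarrow> 'a task \<Rightarrow> 'a \<Rightarrow> real" where
  "utility S T j =
     w_sim S * cap_score S T j + w_load S * (1 - load S T j) + w_price S * (1 - norm_price S T j)"

definition eligible :: "'a snapshot \<Rightarrow> 'a task \<Rightarrow> 'a set" where
  "eligible S T =
     {j \<in> svc S. active S j \<and> cap_ind S T j = 1 \<and> load S T j < 1 \<and> min_trust T \<le> trust S j \<and>
        ret_valid S j (source T) \<and>
        price S T j + ret_cost S j (source T) \<le> budget T \<and>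
        exec_delay S T j + ret_delay S j (source T) \<le> deadline T}"

definition gated_utility :: "'a snapshot \<Rightarrow> 'a task \<Rightarrow> 'a \<Rightarrow> real" where
  "gated_utility S T j = (if j \<in> eligible S T then utility S T j else 0)"

definition potential :: "'a snapshot \<Rightarrow> 'a task \<Rightarrow> 'a \<Rightarrow> 'a \<Rightarrow> real" where
  "potential S T i j = gated_utility S T j * exp (- hop_weight S * real (stored_hop S i j))"

definition visible_eligible :: "'a snapshot \<Rightarrow> 'a task \<Rightarrow> 'a \<Rightarrow> 'a set" where
  "visible_eligible S T i = eligible S T \<inter> visible S i"

definition visible_eligible_pos :: "'a snapshot \<Rightarrow> 'a task \<Rightarrow> 'a \<Rightarrow> 'a set" where
  "visible_eligible_pos S T i = {j \<in> visible_eligible S T i. gated_utility S T j > 0}"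

definition hop_objective :: "'a snapshot \<Rightarrow> 'a task \<Rightarrow> 'a \<Rightarrow> 'a \<Rightarrow> real" where
  "hop_objective S T s j =
     gated_utility S T j * hop_decay (hop_weight S) (hop_dist (graph_of S) s j)"

definition opt_value :: "'a snapshot \<Rightarrow> 'a task \<Rightarrow> 'a \<Rightarrow> real" where
  "opt_value S T s =
     (if eligible S T = {} then 0 else Max (hop_objective S T s ` eligible S T))"

text \<open>
  Ties are broken by the order on the identifier type, which is an arbitrary total order.
\<close>

definition dominant :: "('a::linorder) snapshot \<Rightarrow> 'a task \<Rightarrow> 'a \<Rightarrow> 'a" where
  "dominant S T i =
     Min {j. is_arg_max (potential S T i) (\<lambda>k. k \<in> visible_eligible_pos S T i) j}"

text \<open>
  \<open>spfr_from S T n i\<close> is the outcome of the rule at agent \<open>i\<close> when at most \<open>n\<close> further forwarding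
  steps are allowed: \<open>Some m\<close> if it terminates with executor \<open>m\<close>, and \<open>None\<close> for ``no route''.
\<close>

primrec spfr_from :: "('a::linorder) snapshot \<Rightarrow> 'a task \<Rightarrow> nat \<Rightarrow> 'a \<Rightarrow> 'a option" where
  "spfr_from S T 0 i =
     (if visible_eligible_pos S T i = {} then None
      else if dominant S T i = i then Some i
      else None)"
| "spfr_from S T (Suc n) i =
     (if visible_eligible_pos S T i = {} then None
      else if dominant S T i = i then Some i
      else spfr_from S T n (next_hop S i (dominant S T i)))"

definition spfr :: "('a::linorder) snapshot \<Rightarrow> 'a task \<Rightarrow> 'a option" where
  "spfr S T = spfr_from S T (card (pverts (graph_of S)) - 1) (source T)"

definition ttl_complete :: "'a snapshot \<Rightarrow> bool" where
  "ttl_complete S \<longleftrightarrow>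
     (\<forall>i \<in> pverts (graph_of S).
        visible S i = {j \<in> svc S. hop_dist (graph_of S) i j \<le> enat (horizon S)} \<and>
        (\<forall>j \<in> visible S i. enat (stored_hop S i j) = hop_dist (graph_of S) i j))"

text \<open>The subtraction is on integers, as it would be truncated on natural numbers.\<close>

definition next_hop_closed :: "'a snapshot \<Rightarrow> bool" where
  "next_hop_closed S \<longleftrightarrow>
     (\<forall>i \<in> pverts (graph_of S). \<forall>j \<in> visible S i. j \<noteq> i \<longrightarrow>
        (let k = next_hop S i j in
           j \<in> visible S k \<and> int (stored_hop S k j) = int (stored_hop S i j) - 1))"

end

theory Submission
  imports Defs
begin

text \<open>
  When the horizon covers the diameter, every agent sees the same candidates. A forwarding step
  towards a maximizer \<open>j\<close> multiplies the potential of \<open>j\<close> by \<open>exp \<omega>\<close>, where \<open>\<omega>\<close> is the hop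
  weight, and by the triangle inequality it multiplies no other potential by more than that. Hence
  \<open>j\<close> stays maximal and the set of maximizers can only shrink along the route; the executor
  maximizes the potential at its own position, so it also does at the source.
\<close>

text \<open>The chain \<open>c * f j = g j \<le> g m \<le> c * f m\<close> makes \<open>m\<close> at
  least as good as the maximizer \<open>j\<close> under \<open>f\<close>. Below, \<open>f\<close>
  and \<open>g\<close> are the potentials before and after one forwarding step towards
  \<open>j\<close>.\<close>

lemma is_arg_max_antimono_scaling:
  fixes f g :: "'a \<Rightarrow> 'b::linordered_idom"
  assumes j: "is_arg_max f P j" and m: "is_arg_max g P m"
    and "0 < c" and gain: "g j = c * f j" and "\<And>l. P l \<Longrightarrow> g l \<le> c * f l"
  shows "is_arg_max f P m"
proof -
  have "P j" "P m" and "g j \<le> g m" and max_j: "\<And>l. P l \<Longrightarrow> f l \<le> f j"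
    using j m by (auto simp: is_arg_max_linorder)
  then have "c * f j \<le> c * f m"
    using gain assms(5)[OF \<open>P m\<close>] by linarith
  then have "f j \<le> f m"
    using \<open>0 < c\<close> by simp
  then show ?thesis
    using \<open>P m\<close> max_j by (force simp: is_arg_max_linorder intro: order_trans)
qed

lemma Min_is_arg_max:
  fixes f :: "'a::linorder \<Rightarrow> 'b::linorder"
  assumes "finite A" "A \<noteq> {}"
  shows "is_arg_max f (\<lambda>x. x \<in> A) (Min {x. is_arg_max f (\<lambda>x. x \<in> A) x})"
proof -
  let ?M = "{x. is_arg_max f (\<lambda>x. x \<in> A) x}"
  have "finite ?M"
    by (rule finite_subset[OF _ assms(1)]) (auto simp: is_arg_max_def)
  moreover obtain x where "x \<in> A" "f x = Max (f ` A)"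
    using Max_in[of "f ` A"] assms by fastforce
  then have "x \<in> ?M"
    using assms(1) by (auto simp: is_arg_max_linorder)
  ultimately have "Min ?M \<in> ?M"
    by (intro Min_in) auto
  then show ?thesis by simp
qed

lemma hop_dist_arc:
  assumes "pair_graph G" and arc: "(u, w) \<in> parcs G"
  shows "hop_dist G u v \<le> eSuc (hop_dist G w v)"
proof (cases "{p. pre_digraph.awalk (with_proj G) w p v} = {}")
  case True
  then have "hop_dist G w v = \<infinity>"
    unfolding hop_dist_def by (metis INF_empty top_enat_def)
  then show ?thesis by simp
next
  case False
  interpret pair_graph G by fact
  from False obtain q where "awalk w q v" by auto
  \<comment> \<open>Since \<open>enat\<close> is well-ordered, the infimum over a nonempty set is
    attained; a shortest walk from \<open>w\<close> can then be prolonged backwards by the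
    arc.\<close>
  then have "hop_dist G w v \<in> (\<lambda>p. enat (length p)) ` {p. awalk w p v}"
    unfolding hop_dist_def by (intro wellorder_InfI[OF imageI]) simp
  then obtain p where p: "awalk w p v" "hop_dist G w v = enat (length p)"
    by auto
  have "awalk u ((u, w) # p) v"
    using p(1) arc by (simp add: awalk_Cons_iff)
  then have "hop_dist G u v \<le> enat (length ((u, w) # p))"
    unfolding hop_dist_def by (intro INF_lower) simp
  then show ?thesis
    using p(2) by (simp add: eSuc_enat)
qed

lemma hop_dist_le_hop_diam:
  assumes "pair_graph G" "u \<in> pverts G" "v \<in> pverts G"
  shows "hop_dist G u v \<le> hop_diam G"
proof -
  interpret pair_graph G by fact
  have "{hop_dist G u v | u v. u \<in> pverts G \<and> v \<in> pverts G}
      = (\<lambda>(u, v). hop_dist G u v) ` (pverts G \<times> pverts G)"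
    by auto
  \<comment> \<open>\<open>Max\<close> is an upper bound only for finite sets, so finiteness of the
    set of distances has to come first.\<close>
  then have "finite {hop_dist G u v | u v. u \<in> pverts G \<and> v \<in> pverts G}"
    using pair_finite_verts by simp
  then show ?thesis
    unfolding hop_diam_def using assms by (intro Max_ge) auto
qed

context task_snapshot
begin

text \<open>No distance between two agents exceeds the diameter, so the horizon filters out no
  service agent.\<close>

lemma visible_covered:
  assumes "ttl_complete S" "hop_diam (graph_of S) \<le> enat (horizon S)"
    and "i \<in> pverts (graph_of S)"
  shows "visible S i = svc S"
proof -
  have "hop_dist (graph_of S) i j \<le> enat (horizon S)" if "j \<in> svc S" for j
    using hop_dist_le_hop_diam[OF graph assms(3)] that svc_subset assms(2)
    by (meson order_trans subsetD)
  then show ?thesis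
    using assms(1,3) by (auto simp: ttl_complete_def)
qed

lemma next_hop_in_verts:
  assumes "i \<in> pverts (graph_of S)" "j \<in> visible S i" "j \<noteq> i"
  shows "next_hop S i j \<in> pverts (graph_of S)"
proof -
  interpret pair_graph "graph_of S" by (rule graph)
  show ?thesis
    using next_hop_shortest[OF assms] in_arcsD2 by blast
qed

lemma potential_eq_hop_objective:
  assumes "ttl_complete S" "i \<in> pverts (graph_of S)" "j \<in> visible S i"
  shows "potential S T i j = hop_objective S T i j"
proof -
  have "hop_dist (graph_of S) i j = enat (stored_hop S i j)"
    using assms by (auto simp: ttl_complete_def)
  then show ?thesis
    by (simp add: potential_def hop_objective_def hop_decay_def)
qed

lemma potential_next_hop_self:
  assumes "next_hop_closed S" "i \<in> pverts (graph_of S)" "j \<in> visible S i" "j \<noteq> i"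
  shows "potential S T (next_hop S i j) j = exp (hop_weight S) * potential S T i j"
proof -
  \<comment> \<open>Moving the 1 across turns the integer subtraction of
    \<open>next_hop_closed\<close> into an addition, which carries over to the reals.\<close>
  have "int (stored_hop S i j) = int (stored_hop S (next_hop S i j) j) + 1"
    using assms unfolding next_hop_closed_def Let_def by fastforce
  then have "real (stored_hop S i j) = real (stored_hop S (next_hop S i j) j) + 1"
    by linarith
  then show ?thesis
    by (simp add: potential_def algebra_simps flip: exp_add)
qed

text \<open>Crossing one arc brings any \<open>l\<close> closer by at most one hop, so the decay
  factor grows by at most \<open>exp (hop_weight S)\<close>. A nonnegative gated utility preserves
  this bound.\<close>

lemma potential_arc_le:
  assumes "ttl_complete S" and arc: "(i, k) \<in> parcs (graph_of S)"
    and i: "i \<in> pverts (graph_of S)" "l \<in> visible S i"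
    and k: "k \<in> pverts (graph_of S)" "l \<in> visible S k"
    and "0 \<le> gated_utility S T l"
  shows "potential S T k l \<le> exp (hop_weight S) * potential S T i l"
proof -
  have "enat (stored_hop S i l) \<le> eSuc (enat (stored_hop S k l))"
    using hop_dist_arc[OF graph arc, of l] assms(1) i k by (simp add: ttl_complete_def)
  then have "real (stored_hop S i l) \<le> real (stored_hop S k l) + 1"
    by (simp add: eSuc_enat)
  then have "hop_weight S * real (stored_hop S i l) \<le> hop_weight S * (real (stored_hop S k l) + 1)"
    using hop_weight_pos by (intro mult_left_mono) auto
  then have "exp (- hop_weight S * real (stored_hop S k l))
      \<le> exp (hop_weight S) * exp (- hop_weight S * real (stored_hop S i l))"
    by (simp add: algebra_simps flip: exp_add)
  then show ?thesis
    using mult_left_mono[OF _ assms(7)] unfolding potential_def by (metis mult.left_commute)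
qed

end

text \<open>Each forwarding step spends one unit of the budget \<open>n\<close> and changes the
  agent, so the induction is on \<open>n\<close> with \<open>i\<close> arbitrary. Maximality is
  first known at the executor and is pulled back one hop at a time.\<close>

lemma spfr_from_is_arg_max:
  fixes S :: "('a::linorder) snapshot"
  assumes "task_snapshot S T" "ttl_complete S" "next_hop_closed S"
    and "hop_diam (graph_of S) \<le> enat (horizon S)"
    and "i \<in> pverts (graph_of S)" "spfr_from S T n i = Some m"
  shows "is_arg_max (potential S T i) (\<lambda>j. j \<in> visible_eligible_pos S T i) m"
  using assms(5,6)
proof (induction n arbitrary: i)
  interpret task_snapshot S T by fact
  interpret pair_graph "graph_of S" by (rule graph)
  note visible = visible_covered[OF assms(2,4)]
  have dominant: "is_arg_max (potential S T i) (\<lambda>j. j \<in> visible_eligible_pos S T i) (dominant S T i)"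
    if "i \<in> pverts (graph_of S)" "visible_eligible_pos S T i \<noteq> {}" for i
  proof -
    have "visible_eligible_pos S T i \<subseteq> pverts (graph_of S)"
      using svc_subset visible[OF that(1)]
      by (auto simp: visible_eligible_pos_def visible_eligible_def)
    then show ?thesis
      unfolding dominant_def using that(2) pair_finite_verts
      by (intro Min_is_arg_max) (auto intro: finite_subset)
  qed
  {
    case 0
    then show ?case
      using dominant[of i] by (auto split: if_splits)
  next
    case (Suc n)
    let ?j = "dominant S T i"
    let ?k = "next_hop S i ?j"
    have nonempty: "visible_eligible_pos S T i \<noteq> {}"
      using Suc.prems(2) by auto
    note max_i = dominant[OF Suc.prems(1) nonempty]
    show ?case
    proof (cases "?j = i")
      case True
      then show ?thesis
        using Suc.prems(2) nonempty max_i by simp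
    next
      case False
      have j: "?j \<in> visible S i"
        using max_i by (auto simp: is_arg_max_def visible_eligible_pos_def visible_eligible_def)
      note k = next_hop_in_verts[OF Suc.prems(1) j False]
      \<comment> \<open>Both agents see all of \<open>svc S\<close>, so the two maximizations range
        over the same candidates and differ only in the potential.\<close>
      have same: "visible_eligible_pos S T ?k = visible_eligible_pos S T i"
        using visible[OF k] visible[OF Suc.prems(1)]
        by (simp add: visible_eligible_pos_def visible_eligible_def)
      have "spfr_from S T n ?k = Some m"
        using Suc.prems(2) nonempty False by simp
      then have max_k: "is_arg_max (potential S T ?k) (\<lambda>j. j \<in> visible_eligible_pos S T i) m"
        using Suc.IH[OF k] same by simp
      show ?thesis
      \<comment> \<open>The scaling factor is \<open>exp (hop_weight S)\<close>: attained exactly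
        for the target \<open>?j\<close>, an upper bound for every other candidate.\<close>
      proof (rule is_arg_max_antimono_scaling[OF max_i max_k])
        show "potential S T ?k ?j = exp (hop_weight S) * potential S T i ?j"
          by (rule potential_next_hop_self[OF assms(3) Suc.prems(1) j False])
        show "potential S T ?k l \<le> exp (hop_weight S) * potential S T i l"
          if "l \<in> visible_eligible_pos S T i" for l
          using that same next_hop_shortest[OF Suc.prems(1) j False] Suc.prems(1) k
          by (intro potential_arc_le[OF assms(2)])
            (auto simp: visible_eligible_pos_def visible_eligible_def)
      qed simp
    qed
  }
qed

theorem theorem4:
  fixes S :: "('a::linorder) snapshot" and T :: "'a task" and m :: 'a
  assumes "task_snapshot S T"
    and "ttl_complete S"
    and "next_hop_closed S"
    and "visible_eligible_pos S T (source T) \<noteq> {}"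
    and "opt_value S T (source T) > 0"
    and "enat (horizon S) \<ge> hop_diam (graph_of S)"
    and "spfr S T = Some m"
  shows "is_arg_max (\<lambda>j. gated_utility S T j *
             hop_decay (hop_weight S) (hop_dist (graph_of S) (source T) j))
           (\<lambda>j. j \<in> eligible S T) m"
proof -
  interpret task_snapshot S T by fact
  let ?s = "source T"
  have visible: "visible S ?s = svc S"
    by (rule visible_covered[OF assms(2,6) source_agent])
  have eligible: "visible_eligible S T ?s = eligible S T"
    using visible by (auto simp: visible_eligible_def eligible_def)
  have max_pos: "is_arg_max (potential S T ?s) (\<lambda>j. j \<in> visible_eligible_pos S T ?s) m"
    using spfr_from_is_arg_max[OF assms(1-3,6) source_agent] assms(7) by (simp add: spfr_def)
  then have m: "m \<in> eligible S T" "0 < potential S T ?s m"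
    by (auto simp: is_arg_max_def visible_eligible_pos_def eligible potential_def)
  \<comment> \<open>The rule only compares candidates of positive gated utility. Any other eligible
    agent has a nonpositive potential and cannot beat the positive one of \<open>m\<close>.\<close>
  have "potential S T ?s l \<le> potential S T ?s m" if "l \<in> eligible S T" for l
  proof (cases "0 < gated_utility S T l")
    case True
    then show ?thesis
      using that max_pos by (auto simp: is_arg_max_linorder visible_eligible_pos_def eligible)
  next
    case False
    then have "potential S T ?s l \<le> 0"
      by (simp add: potential_def mult_le_0_iff)
    then show ?thesis using m(2) by simp
  qed
  \<comment> \<open>Every eligible agent is visible from the source, so its stored hop count is the
    true distance there.\<close>
  moreover have "potential S T ?s l = hop_objective S T ?s l" if "l \<in> eligible S T" for l
    using that visible by (intro potential_eq_hop_objective[OF assms(2) source_agent])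
      (auto simp: eligible_def)
  ultimately show ?thesis
    using m(1) unfolding is_arg_max_linorder hop_objective_def by metis
qed

end
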